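(* Let $d\ge 2$ be an integer and $a\in\mathbb{Q}^*$. For $b\in\{1,-1\}$ let $\psi_{d,a,b}(z)=\frac{z}{az^d+b}$, viewed as a map $\mathbb{P}^1\to\mathbb{P}^1$. Then \[\#\textup{PrePer}\bigl(\psi_{d,a,1},\mathbb{P}^1(\mathbb{Q})\bigr)\le 6\quad\text{and}\quad \#\textup{PrePer}\bigl(\psi_{d,a,-1},\mathbb{P}^1(\mathbb{Q})\bigr)\le 6.\]
   Context: In homogeneous coordinates $\psi_{d,a,b}([X,Y]) = [XY^{d-1}, aX^d+bY^d]$. $\textup{PrePer}(\phi,\mathbb{P}^1(\mathbb{Q}))$ is the set of points of $\mathbb{P}^1(\mathbb{Q})$ with finite forward orbit under $\phi$. *)

theory Defs
  imports Complex_Main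
begin

definition proj1_rel :: "'a::field \<times> 'a \<Rightarrow> 'a \<times> 'a \<Rightarrow> bool" where
  "proj1_rel p q \<longleftrightarrow>
     p \<noteq> (0, 0) \<and> q \<noteq> (0, 0) \<and> (\<exists>c. c \<noteq> 0 \<and> q = (c * fst p, c * snd p))"

lemma part_equivp_proj1_rel: "part_equivp (proj1_rel :: 'a::field \<times> 'a \<Rightarrow> _)"
proof (rule part_equivpI)
  have "proj1_rel (0, 1) ((0, 1) :: 'a \<times> 'a)"
    unfolding proj1_rel_def by (auto intro: exI[of _ 1])
  then show "\<exists>x. proj1_rel x (x :: 'a \<times> 'a)" ..
  show "symp (proj1_rel :: 'a \<times> 'a \<Rightarrow> _)"
  proof (rule sympI)
    fix p q :: "'a \<times> 'a" assume "proj1_rel p q"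
    then obtain c where c: "p \<noteq> (0, 0)" "q \<noteq> (0, 0)" "c \<noteq> 0" "q = (c * fst p, c * snd p)"
      unfolding proj1_rel_def by blast
    then have "p = (inverse c * fst q, inverse c * snd q)"
      by (simp add: mult.assoc [symmetric])
    then show "proj1_rel q p"
      unfolding proj1_rel_def using c by (metis inverse_nonzero_iff_nonzero)
  qed
  show "transp (proj1_rel :: 'a \<times> 'a \<Rightarrow> _)"
  proof (rule transpI)
    fix p q r :: "'a \<times> 'a" assume "proj1_rel p q" "proj1_rel q r"
    then obtain c e where c: "p \<noteq> (0, 0)" "r \<noteq> (0, 0)" "c \<noteq> 0" "q = (c * fst p, c * snd p)"
      "e \<noteq> 0" "r = (e * fst q, e * snd q)"
      unfolding proj1_rel_def by blast
    then have "e * c \<noteq> 0" "r = (e * c * fst p, e * c * snd p)" by (simp_all add: mult.assoc)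
    then show "proj1_rel p r" unfolding proj1_rel_def using c by blast
  qed
qed

quotient_type (overloaded) 'a proj1 = "'a::field \<times> 'a" / partial: proj1_rel
  by (rule part_equivp_proj1_rel)

text \<open>\<open>proj1_pt X Y\<close> is the point \<open>[X, Y]\<close>; it is only meaningful for \<open>(X, Y) \<noteq> (0, 0)\<close>.\<close>

definition proj1_pt :: "'a::field \<Rightarrow> 'a \<Rightarrow> 'a proj1" where
  "proj1_pt X Y = abs_proj1 (X, Y)"

definition psi :: "nat \<Rightarrow> 'a::field \<Rightarrow> 'a \<Rightarrow> 'a proj1 \<Rightarrow> 'a proj1" where
  "psi d a b P = (case rep_proj1 P of (X, Y) \<Rightarrow> proj1_pt (X * Y ^ (d - 1)) (a * X ^ d + b * Y ^ d))"

definition PrePer :: "('p \<Rightarrow> 'p) \<Rightarrow> 'p set" where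
  "PrePer f = {P. finite (range (\<lambda>n::nat. (f ^^ n) P))}"

text \<open>The definition of \<^const>\<open>psi\<close> picks a representative; the following facts confirm that
  \<^const>\<open>psi\<close> does not depend on it and that it extends \<open>z \<mapsto> z / (a z\<^sup>d + b)\<close>.\<close>

lemma proj1_pt_eq_iff:
  assumes "(X, Y) \<noteq> (0, 0)" "(X', Y') \<noteq> (0, 0)"
  shows "proj1_pt X Y = proj1_pt X' Y' \<longleftrightarrow> (\<exists>c. c \<noteq> 0 \<and> X' = c * X \<and> Y' = c * Y)"
proof -
  have refl: "proj1_rel p p" if "p \<noteq> (0, 0)" for p :: "'a \<times> 'a"
    using that unfolding proj1_rel_def by (auto intro: exI[of _ 1])
  have "proj1_pt X Y = proj1_pt X' Y' \<longleftrightarrow> proj1_rel (X, Y) (X', Y')"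
    unfolding proj1_pt_def
    using Quotient3_rel[OF Quotient3_proj1, of "(X, Y)" "(X', Y')"] refl assms by blast
  then show ?thesis using assms by (simp add: proj1_rel_def)
qed

lemma proj1_cases:
  obtains X Y where "(X, Y) \<noteq> (0, 0)" "P = proj1_pt X Y" "rep_proj1 P = (X, Y)"
proof -
  obtain X Y where XY: "rep_proj1 P = (X, Y)" by fastforce
  have "proj1_rel (X, Y) (X, Y)" using Quotient3_rep_reflp[OF Quotient3_proj1, of P] XY by simp
  then have "(X, Y) \<noteq> (0, 0)" by (simp add: proj1_rel_def)
  moreover have "P = proj1_pt X Y"
    unfolding proj1_pt_def using Quotient3_abs_rep[OF Quotient3_proj1, of P] XY by simp
  ultimately show thesis using that XY by blast
qed

lemma psi_nonzero:
  fixes a b X Y :: "'a::field"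
  assumes "d \<ge> 2" "a \<noteq> 0" "b \<noteq> 0" "(X, Y) \<noteq> (0, 0)"
  shows "(X * Y ^ (d - 1), a * X ^ d + b * Y ^ d) \<noteq> (0, 0)"
  using assms by (cases "X = 0"; cases "Y = 0") (auto simp: power_0_left)

lemma psi_proj1_pt:
  assumes "d \<ge> 2" "a \<noteq> 0" "b \<noteq> 0" "(X, Y) \<noteq> (0, 0)"
  shows "psi d a b (proj1_pt X Y) = proj1_pt (X * Y ^ (d - 1)) (a * X ^ d + b * Y ^ d)"
proof -
  obtain X' Y' where r: "(X', Y') \<noteq> (0, 0)" "proj1_pt X Y = proj1_pt X' Y'"
    "rep_proj1 (proj1_pt X Y) = (X', Y')"
    by (rule proj1_cases)
  then obtain c where c: "c \<noteq> 0" "X' = c * X" "Y' = c * Y"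
    using proj1_pt_eq_iff assms(4) by blast
  have "c ^ d = c * c ^ (d - 1)"
    using assms(1) by (metis Suc_diff_1 gr0I not_numeral_le_zero power_Suc)
  then have "X' * Y' ^ (d - 1) = c ^ d * (X * Y ^ (d - 1))"
    "a * X' ^ d + b * Y' ^ d = c ^ d * (a * X ^ d + b * Y ^ d)"
    using c by (simp_all add: power_mult_distrib algebra_simps)
  then have "proj1_pt (X * Y ^ (d - 1)) (a * X ^ d + b * Y ^ d)
      = proj1_pt (X' * Y' ^ (d - 1)) (a * X' ^ d + b * Y' ^ d)"
    using proj1_pt_eq_iff[OF psi_nonzero[OF assms] psi_nonzero[OF assms(1-3) r(1)]] c(1)
    by (metis power_not_zero)
  then show ?thesis using r(3) by (simp add: psi_def)
qed

lemma psi_affine: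
  assumes "d \<ge> 2" "a \<noteq> 0" "b \<noteq> 0" "a * z ^ d + b \<noteq> 0"
  shows "psi d a b (proj1_pt z 1) = proj1_pt (z / (a * z ^ d + b)) 1"
proof -
  have "psi d a b (proj1_pt z 1) = proj1_pt z (a * z ^ d + b)"
    using psi_proj1_pt[OF assms(1-3), of z 1] by simp
  also have "\<dots> = proj1_pt (z / (a * z ^ d + b)) 1"
    using assms(4) by (subst proj1_pt_eq_iff) (auto intro: exI[of _ "1 / (a * z ^ d + b)"])
  finally show ?thesis .
qed

end

theory Submission
  imports Defs
begin

text \<open>Put \<open>N = a z\<^sup>d\<close>. Under \<open>z \<mapsto> z / (a z\<^sup>d + b)\<close> it moves by \<open>N \<mapsto> N / (N + b)\<^sup>d\<close>. If \<open>N = p / q\<close> in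
  lowest terms and \<open>b = \<plusminus>1\<close>, then \<open>p q\<^bsup>d-1\<^esup> / (p + b q)\<^sup>d\<close> is again in lowest terms, so the numerator
  never decreases in absolute value and stays constant only where \<open>q = 1\<close>. Boundedness along a
  finite orbit thus forces \<open>N\<close> to reach \<open>-b\<close> (mapped to infinity) or the value \<open>-2b\<close>, unless
  \<open>N = 0\<close>; the only other value leading there is \<open>-b/2\<close>, for \<open>d = 2\<close>. Each value of \<open>N\<close> has at most two
  preimages \<open>z\<close>, and since 2 is not a \<open>d\<close>-th power in the rationals, \<open>-b\<close> does not occur together
  with \<open>-2b\<close> or \<open>-b/2\<close>.\<close>

section \<open>The induced map on \<open>N\<close> in lowest terms\<close>

definition inv_step :: "nat \<Rightarrow> 'a::field \<Rightarrow> 'a \<Rightarrow> 'a" where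
  "inv_step d b N = N / (N + b) ^ d"

text \<open>Sufficient but not necessary for an infinite orbit: for \<open>b = 1\<close> and odd
  \<open>d\<close>, the value -2 fails it, yet moves to 2, which satisfies it.\<close>

definition wandering :: "nat \<Rightarrow> 'a::field \<Rightarrow> 'a \<Rightarrow> bool" where
  "wandering d b N \<longleftrightarrow> N \<noteq> 0 \<and> N \<noteq> - b \<and> N \<noteq> - 2 * b \<and> \<not> (d = 2 \<and> N = - b / 2)"

definition abs_num :: "rat \<Rightarrow> int" where
  "abs_num r = \<bar>fst (quotient_of r)\<bar>"

definition denom :: "rat \<Rightarrow> int" where
  "denom r = snd (quotient_of r)"

lemma rat_lowest_terms:
  obtains p q where "q > 0" "coprime p q" "r = of_int p / of_int q" "abs_num r = \<bar>p\<bar>" "denom r = q"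
proof -
  obtain p q where "quotient_of r = (p, q)" by fastforce
  then show thesis
    using that quotient_of_coprime quotient_of_denom_pos quotient_of_div
    by (metis abs_num_def denom_def fst_conv snd_conv)
qed

lemma abs_num_denom_div:
  assumes "coprime p q" "q \<noteq> 0"
  shows "abs_num (of_int p / of_int q) = \<bar>p\<bar>" "denom (of_int p / of_int q) = \<bar>q\<bar>"
proof -
  have "quotient_of (of_int p / of_int q) = Rat.normalize (p, q)"
    by (metis Fract_of_int_quotient quotient_of_Fract)
  then show "abs_num (of_int p / of_int q) = \<bar>p\<bar>" "denom (of_int p / of_int q) = \<bar>q\<bar>"
    using assms by (auto simp: abs_num_def denom_def Rat.normalize_def Let_def)
qed

text \<open>Since \<open>e\<close> is a unit, \<open>p + e * q\<close> is coprime to both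
  \<open>p\<close> and \<open>q\<close>, so nothing cancels in
  \<open>p * q ^ (d - 1) / (p + e * q) ^ d\<close>.\<close>

lemma inv_step_lowest_terms:
  fixes p q e :: int
  assumes "d \<ge> 1" "\<bar>e\<bar> = 1" "coprime p q" "q > 0" "p + e * q \<noteq> 0"
  shows "abs_num (inv_step d (of_int e) (of_int p / of_int q)) = \<bar>p\<bar> * q ^ (d - 1)"
    and "denom (inv_step d (of_int e) (of_int p / of_int q)) = \<bar>p + e * q\<bar> ^ d"
proof -
  have e: "e = 1 \<or> e = -1" using assms(2) by linarith
  have "coprime p (p + e * q)"
  proof (rule coprimeI)
    fix c assume "c dvd p" "c dvd p + e * q"
    then have "c dvd p" "c dvd q" using e by (auto simp: dvd_add_right_iff dvd_diff_right_iff)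
    then show "is_unit c" using assms(3) coprime_common_divisor by blast
  qed
  moreover have "coprime q (p + e * q)"
  proof (rule coprimeI)
    fix c assume "c dvd q" "c dvd p + e * q"
    then have "c dvd p" "c dvd q" by (auto simp: dvd_add_left_iff)
    then show "is_unit c" using assms(3) coprime_common_divisor by blast
  qed
  ultimately have cop: "coprime (p * q ^ (d - 1)) ((p + e * q) ^ d)" by simp
  have "of_int p / of_int q + of_int e = (of_int (p + e * q) / of_int q :: rat)"
    using assms(4) by (simp add: field_simps)
  then have "inv_step d (of_int e) (of_int p / of_int q :: rat) =
      of_int p * of_int q ^ d / (of_int q * of_int (p + e * q) ^ d)"
    by (simp add: inv_step_def power_divide del: of_int_add)
  \<comment> \<open>One factor \<open>q\<close> cancels: \<open>q ^ d = q * q ^ (d - 1)\<close>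
    because \<open>d\<close> is positive.\<close>
  also have "\<dots> = of_int (p * q ^ (d - 1)) / of_int ((p + e * q) ^ d)"
    using assms(1,4) by (cases d) auto
  finally show "abs_num (inv_step d (of_int e) (of_int p / of_int q)) = \<bar>p\<bar> * q ^ (d - 1)"
    and "denom (inv_step d (of_int e) (of_int p / of_int q)) = \<bar>p + e * q\<bar> ^ d"
    using abs_num_denom_div[OF cop] assms(4,5) by (simp_all add: abs_mult power_abs)
qed

lemma int_power_neq_2:
  fixes n :: int
  assumes "d \<ge> 2" shows "n ^ d \<noteq> 2"
proof
  assume n: "n ^ d = 2"
  then have abs: "\<bar>n\<bar> ^ d = 2" by (metis abs_numeral power_abs)
  show False
  proof (cases "\<bar>n\<bar> \<le> 1")
    case True
    then show False using abs power_le_one[of "\<bar>n\<bar>" d] by simp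
  next
    case False
    then have "2 ^ 2 \<le> \<bar>n\<bar> ^ 2" by (intro power_mono) auto
    also have "\<dots> \<le> \<bar>n\<bar> ^ d" using False assms by (intro power_increasing) auto
    finally show False using abs by simp
  qed
qed

text \<open>Raising a fraction in lowest terms to a power keeps it in lowest terms, so the numerator
  2 would be an integral \<open>d\<close>-th power up to sign.\<close>

lemma rat_power_neq_2:
  fixes r :: rat
  assumes "d \<ge> 2" shows "r ^ d \<noteq> 2"
proof
  assume r: "r ^ d = 2"
  obtain p q where pq: "q > 0" "coprime p q" "r = of_int p / of_int q" by (rule rat_lowest_terms)
  have "abs_num (r ^ d) = \<bar>p ^ d\<bar>"
    using abs_num_denom_div(1)[of "p ^ d" "q ^ d"] pq by (simp add: power_divide)
  moreover have "abs_num (r ^ d) = 2"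
    using r abs_num_denom_div(1)[of 2 1] by simp
  ultimately show False using int_power_neq_2[OF assms, of "\<bar>p\<bar>"] by (simp add: power_abs)
qed

section \<open>Growth of numerators and infinite orbits\<close>

lemma wandering_lowest_terms:
  fixes N :: rat and e :: int
  assumes d: "d \<ge> 2" and e: "\<bar>e\<bar> = 1" and N: "wandering d (of_int e) N"
  obtains p q where "q > 0" "coprime p q" "N = of_int p / of_int q" "abs_num N = \<bar>p\<bar>" "denom N = q"
    "p \<noteq> 0" "p + e * q \<noteq> 0"
    "abs_num (inv_step d (of_int e) N) = \<bar>p\<bar> * q ^ (d - 1)"
    "denom (inv_step d (of_int e) N) = \<bar>p + e * q\<bar> ^ d"
    "denom (inv_step d (of_int e) N) = 1 \<Longrightarrow> \<bar>p + e * q\<bar> = 1"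
proof -
  obtain p q where pq: "q > 0" "coprime p q" "N = of_int p / of_int q" "abs_num N = \<bar>p\<bar>" "denom N = q"
    by (rule rat_lowest_terms)
  have p0: "p \<noteq> 0" using N pq(3) by (auto simp: wandering_def)
  have peq: "p + e * q \<noteq> 0"
  proof
    assume "p + e * q = 0"
    then have "p = - e * q" by simp
    then show False using N pq(1,3) by (simp add: wandering_def)
  qed
  have num: "abs_num (inv_step d (of_int e) N) = \<bar>p\<bar> * q ^ (d - 1)"
    and den: "denom (inv_step d (of_int e) N) = \<bar>p + e * q\<bar> ^ d"
    using inv_step_lowest_terms[of d e p q] d e pq peq by auto
  have "\<bar>p + e * q\<bar> = 1" if "denom (inv_step d (of_int e) N) = 1"
    using that den d power_eq_imp_eq_base[of "\<bar>p + e * q\<bar>" d 1] by simp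
  then show thesis using that pq p0 peq num den by blast
qed

text \<open>The image has numerator \<open>\<bar>p\<bar> * q ^ (d - 1)\<close>, which is at least
  \<open>q\<close> and at least \<open>\<bar>p\<bar>\<close>. An exceptional image therefore leaves
  only a few small \<open>p\<close> and \<open>q\<close>, all of them exceptional already.\<close>

lemma wandering_inv_step:
  fixes N :: rat and e :: int
  assumes d: "d \<ge> 2" and e: "\<bar>e\<bar> = 1" and N: "wandering d (of_int e) N"
  shows "wandering d (of_int e) (inv_step d (of_int e) N)"
proof -
  have e': "e = 1 \<or> e = -1" using e by linarith
  define N' where "N' = inv_step d (of_int e) N"
  obtain p q where pq: "q > 0" "coprime p q" "N = of_int p / of_int q" and p0: "p \<noteq> 0"
    and peq: "p + e * q \<noteq> 0" and num: "abs_num N' = \<bar>p\<bar> * q ^ (d - 1)"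
    and den: "denom N' = \<bar>p + e * q\<bar> ^ d" and unit: "denom N' = 1 \<Longrightarrow> \<bar>p + e * q\<bar> = 1"
    using wandering_lowest_terms[OF d e N] unfolding N'_def by metis
  have ad: "abs_num (- of_int e) = 1" "denom (- of_int e) = 1"
    "abs_num (- 2 * of_int e) = 2" "denom (- 2 * of_int e) = 1"
    "denom (- of_int e / 2) = 2"
    using e' abs_num_denom_div[of "-1" 1] abs_num_denom_div[of 1 1] abs_num_denom_div[of 2 1]
      abs_num_denom_div[of "-2" 1] abs_num_denom_div[of 1 2] abs_num_denom_div[of "-1" 2]
    by auto
  have q_le: "q \<le> q ^ (d - 1)" using pq(1) d by (intro self_le_power) auto
  have q_bound: "q \<le> \<bar>p\<bar> * q ^ (d - 1)"
    using mult_mono[of 1 "\<bar>p\<bar>" q "q ^ (d - 1)"] p0 q_le pq(1) by simp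
  have p_bound: "\<bar>p\<bar> \<le> \<bar>p\<bar> * q ^ (d - 1)"
    using mult_left_mono[of 1 "q ^ (d - 1)" "\<bar>p\<bar>"] pq(1) q_le by simp
  \<comment> \<open>Numerator 1 leaves \<open>q = 1\<close> and \<open>p = \<plusminus>1\<close>, so
    \<open>p + e\<close> is even and cannot be a unit.\<close>
  have "N' \<noteq> - of_int e"
  proof
    assume eq: "N' = - of_int e"
    then have "q = 1" "\<bar>p\<bar> = 1" using num ad q_bound p_bound pq(1) p0 by auto
    then show False using unit eq ad peq e' by auto
  qed
  moreover have "N' \<noteq> - 2 * of_int e"
  proof
    assume eq: "N' = - 2 * of_int e"
    then have two: "\<bar>p\<bar> * q ^ (d - 1) = 2" using num ad by simp
    have one: "\<bar>p + e * q\<bar> = 1" using unit eq ad by simp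
    have "q = 1 \<or> q = 2" using q_bound two pq(1) by linarith
    then show False
    proof
      assume "q = 1"
      then have "p = - 2 * e" using one two e' by auto
      then show False using N pq \<open>q = 1\<close> by (simp add: wandering_def)
    next
      \<comment> \<open>Coprimality makes \<open>p\<close> odd, so the numerator 2 comes from
        \<open>q ^ (d - 1)\<close> alone. This forces \<open>d = 2\<close> and
        \<open>N = -b/2\<close>, the value excluded for that degree.\<close>
      assume q: "q = 2"
      have "p \<noteq> 2 \<and> p \<noteq> -2" using pq(2) q by auto
      then have p: "\<bar>p\<bar> = 1" using p_bound two p0 by linarith
      then have "(2::int) ^ (d - 1) = 2 ^ 1" using two q by simp
      then have "d - 1 = 1" by (subst (asm) power_inject_exp) auto
      then have "d = 2" by simp
      moreover have "p = - e" using one p q e' by auto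
      ultimately show False using N pq q by (simp add: wandering_def)
    qed
  qed
  moreover have "N' \<noteq> - of_int e / 2"
  proof
    assume "N' = - of_int e / 2"
    then have "\<bar>p + e * q\<bar> ^ d = 2" using den ad by simp
    then show False using int_power_neq_2[OF d] by blast
  qed
  \<comment> \<open>Division by zero yields 0, so \<open>N \<noteq> -b\<close> matters here as well
    as \<open>N \<noteq> 0\<close>.\<close>
  moreover have "N' \<noteq> 0"
    using N by (auto simp: N'_def inv_step_def wandering_def add_eq_0_iff2)
  ultimately show ?thesis by (simp add: wandering_def N'_def)
qed

text \<open>The numerator is multiplied by \<open>q ^ (d - 1)\<close>, which exceeds 1 unless
  \<open>q = 1\<close>. From an integer \<open>p\<close> the next denominator is
  \<open>\<bar>p + e\<bar> ^ d\<close>, equal to 1 only for \<open>p = 0\<close> or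
  \<open>p = -2e\<close>; hence two integral values never follow each other.\<close>

lemma abs_num_inv_step:
  fixes N :: rat and e :: int
  assumes d: "d \<ge> 2" and e: "\<bar>e\<bar> = 1" and N: "wandering d (of_int e) N"
  shows "abs_num (inv_step d (of_int e) N) \<ge> abs_num N"
    and "denom N \<noteq> 1 \<Longrightarrow> abs_num (inv_step d (of_int e) N) > abs_num N"
    and "denom N = 1 \<Longrightarrow> denom (inv_step d (of_int e) N) \<noteq> 1"
proof -
  have e': "e = 1 \<or> e = -1" using e by linarith
  obtain p q where pq: "q > 0" "coprime p q" "N = of_int p / of_int q" "abs_num N = \<bar>p\<bar>" "denom N = q"
    and p0: "p \<noteq> 0" and num: "abs_num (inv_step d (of_int e) N) = \<bar>p\<bar> * q ^ (d - 1)"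
    and unit: "denom (inv_step d (of_int e) N) = 1 \<Longrightarrow> \<bar>p + e * q\<bar> = 1"
    using wandering_lowest_terms[OF d e N] by metis
  have q_le: "q \<le> q ^ (d - 1)" using pq(1) d by (intro self_le_power) auto
  show "abs_num (inv_step d (of_int e) N) \<ge> abs_num N"
    using mult_left_mono[of 1 "q ^ (d - 1)" "\<bar>p\<bar>"] pq(1) q_le unfolding num pq(4) by simp
  show "abs_num (inv_step d (of_int e) N) > abs_num N" if "denom N \<noteq> 1"
    using mult_strict_left_mono[of 1 "q ^ (d - 1)" "\<bar>p\<bar>"] that pq(1,5) q_le p0
    unfolding num pq(4) by simp
  show "denom (inv_step d (of_int e) N) \<noteq> 1" if "denom N = 1"
  proof
    assume "denom (inv_step d (of_int e) N) = 1"
    then have "\<bar>p + e * q\<bar> = 1" by (rule unit)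
    then have "p = - 2 * e" using that pq(5) p0 e' by auto
    then show False using N pq that by (simp add: wandering_def)
  qed
qed

lemma infinite_inv_step_orbit:
  fixes N :: rat and e :: int
  assumes d: "d \<ge> 2" and e: "\<bar>e\<bar> = 1" and N: "wandering d (of_int e) N"
  shows "infinite (range (\<lambda>n. (inv_step d (of_int e) ^^ n) N))"
proof
  define M where "M n = (inv_step d (of_int e) ^^ n) N" for n
  assume "finite (range (\<lambda>n. (inv_step d (of_int e) ^^ n) N))"
  then have "finite (abs_num ` range M)" by (simp add: M_def)
  then obtain B where B: "\<And>n. abs_num (M n) \<le> B"
    by (meson finite_imageI Max_ge rangeI imageI)
  have M_Suc: "M (Suc n) = inv_step d (of_int e) (M n)" for n by (simp add: M_def)
  have wand: "wandering d (of_int e) (M n)" for n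
    by (induction n) (use N wandering_inv_step[OF d e] in \<open>auto simp: M_def\<close>)
  \<comment> \<open>One of two consecutive terms is not an integer, and the step leaving it is
    strict.\<close>
  have two_steps: "abs_num (M (Suc (Suc n))) > abs_num (M n)" for n
    using abs_num_inv_step[OF d e wand[of n]] abs_num_inv_step[OF d e wand[of "Suc n"]]
    unfolding M_Suc by (cases "denom (M n) = 1") auto
  have "int n \<le> abs_num (M (2 * n))" for n
  proof (induction n)
    case (Suc n)
    then show ?case using two_steps[of "2 * n"] by simp
  qed (simp add: abs_num_def)
  from this[of "nat B + 1"] B[of "2 * (nat B + 1)"] show False by linarith
qed

section \<open>Transfer to points of the projective line\<close>

lemma proj1_pt_1_inject: "proj1_pt z 1 = proj1_pt w 1 \<longleftrightarrow> z = w"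
  by (subst proj1_pt_eq_iff) auto

lemma proj1_affine_cases:
  obtains "P = proj1_pt 1 0" | z where "P = proj1_pt z 1"
proof -
  obtain X Y where XY: "(X, Y) \<noteq> (0, 0)" "P = proj1_pt X Y" by (rule proj1_cases)
  show thesis
  proof (cases "Y = 0")
    case True
    then have "proj1_pt X Y = proj1_pt 1 0"
      using XY by (subst proj1_pt_eq_iff) (auto intro: exI[of _ "1 / X"])
    then show thesis using that XY by simp
  next
    case False
    then have "proj1_pt X Y = proj1_pt (X / Y) 1"
      using XY by (subst proj1_pt_eq_iff) (auto intro: exI[of _ "1 / Y"])
    then show thesis using that XY by simp
  qed
qed

text \<open>A finite orbit of the point would give finitely many values of \<open>N\<close> along
  it, against the growth of numerators.\<close>

lemma PrePer_not_wandering: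
  fixes a z :: rat and e :: int
  assumes d: "d \<ge> 2" and a: "a \<noteq> 0" and e: "\<bar>e\<bar> = 1"
    and P: "proj1_pt z 1 \<in> PrePer (psi d a (of_int e))"
  shows "\<not> wandering d (of_int e) (a * z ^ d)"
proof
  assume wand0: "wandering d (of_int e) (a * z ^ d)"
  let ?b = "of_int e :: rat"
  \<comment> \<open>The recursion is total because \<open>x / 0 = 0\<close>. It follows the true
    orbit only while the denominator is nonzero, which \<open>wand\<close> guarantees through
    \<open>N \<noteq> -b\<close>.\<close>
  define y where "y n = ((\<lambda>x. x / (a * x ^ d + ?b)) ^^ n) z" for n
  have y_Suc: "y (Suc n) = y n / (a * y n ^ d + ?b)" for n by (simp add: y_def)
  have step: "a * y (Suc n) ^ d = inv_step d ?b (a * y n ^ d)" for n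
    by (simp add: y_Suc inv_step_def power_divide)
  have wand: "wandering d ?b (a * y n ^ d)" for n
    by (induction n) (use wand0 wandering_inv_step[OF d e] step in \<open>auto simp: y_def\<close>)
  have inv: "a * y n ^ d = (inv_step d ?b ^^ n) (a * z ^ d)" for n
  proof (induction n)
    case (Suc n)
    then show ?case using step[of n] by simp
  qed (simp add: y_def)
  have b0: "?b \<noteq> 0" using e by auto
  have orbit: "(psi d a ?b ^^ n) (proj1_pt z 1) = proj1_pt (y n) 1" for n
  proof (induction n)
    case (Suc n)
    have "a * y n ^ d + ?b \<noteq> 0" using wand[of n] by (auto simp: wandering_def add_eq_0_iff2)
    then show ?case using Suc psi_affine[OF d a b0] by (simp add: y_Suc)
  qed (simp add: y_def)
  have "finite ((\<lambda>x. proj1_pt x 1) ` range y)"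
    using P by (simp add: PrePer_def orbit image_image)
  then have "finite (range y)"
    by (rule finite_imageD) (simp add: inj_on_def proj1_pt_1_inject)
  then have "finite ((\<lambda>x. a * x ^ d) ` range y)" by simp
  then have "finite (range (\<lambda>n. (inv_step d ?b ^^ n) (a * z ^ d)))"
    by (simp add: image_image inv)
  then show False using infinite_inv_step_orbit[OF d e wand0] by simp
qed

section \<open>Counting the exceptional points\<close>

text \<open>In an ordered field \<open>z ^ d\<close> determines the absolute value of
  \<open>z\<close> for positive \<open>d\<close>. An inclusion covers odd \<open>d\<close> and empty
  fibres too.\<close>

lemma power_fibre_subset:
  fixes a c :: "'a::linordered_field"
  assumes "d \<noteq> 0" "a \<noteq> 0"
  obtains x where "{z. a * z ^ d = c} \<subseteq> {x, - x}"
proof (cases "\<exists>x. a * x ^ d = c")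
  case True
  then obtain x where x: "a * x ^ d = c" by blast
  have "z = x \<or> z = - x" if "a * z ^ d = c" for z
  proof -
    have "z ^ d = x ^ d" using that x assms(2) by (metis mult_left_cancel)
    then have "\<bar>z\<bar> ^ d = \<bar>x\<bar> ^ d" by (metis power_abs)
    then have "\<bar>z\<bar> = \<bar>x\<bar>" using assms(1) by (auto intro: power_eq_imp_eq_base)
    then show ?thesis by (auto simp: abs_eq_iff)
  qed
  then show thesis using that by blast
qed (use that in blast)

text \<open>Three nonzero exceptional values could give three pairs \<open>\<plusminus>z\<close>.
  Two pairs suffice: if -b is attained, then -2b and -b/2 are not, since the quotient of the roots
  would have \<open>d\<close>-th power 2.\<close>

lemma non_wandering_fibres:
  fixes a b :: rat
  assumes d: "d \<ge> 2" and a: "a \<noteq> 0" and b: "b \<noteq> 0"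
  obtains x y where "{z. \<not> wandering d b (a * z ^ d)} \<subseteq> {0, x, - x, y, - y}"
proof -
  have d0: "d \<noteq> 0" using d by simp
  obtain x1 where x1: "{z. a * z ^ d = - b} \<subseteq> {x1, - x1}" using power_fibre_subset[OF d0 a] by blast
  obtain x2 where x2: "{z. a * z ^ d = - 2 * b} \<subseteq> {x2, - x2}" using power_fibre_subset[OF d0 a] by blast
  obtain x3 where x3: "{z. a * z ^ d = - b / 2} \<subseteq> {x3, - x3}" using power_fibre_subset[OF d0 a] by blast
  have sub: "{z. \<not> wandering d b (a * z ^ d)} \<subseteq>
      {0} \<union> {z. a * z ^ d = - b} \<union> {z. a * z ^ d = - 2 * b} \<union> {z. a * z ^ d = - b / 2}"
    using a by (auto simp: wandering_def)
  have no_double: "a * z ^ d \<noteq> 2 * (a * w ^ d)" if "w \<noteq> 0" for z w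
  proof
    assume "a * z ^ d = 2 * (a * w ^ d)"
    then have "(z / w) ^ d = 2" using a that by (simp add: power_divide)
    then show False using rat_power_neq_2[OF d] by blast
  qed
  show thesis
  proof (cases "\<exists>w. a * w ^ d = - b")
    case True
    then obtain w where w: "a * w ^ d = - b" by blast
    then have w0: "w \<noteq> 0" using b d0 by (auto simp: power_0_left)
    have "{z. a * z ^ d = - 2 * b} = {}" using no_double[OF w0] w by auto
    moreover have "{z. a * z ^ d = - b / 2} = {}"
    proof -
      have "a * z ^ d \<noteq> - b / 2" for z
        \<comment> \<open>The roles are swapped: -b is twice -b/2, so \<open>z\<close> is now the
          divisor, and \<open>z = 0\<close> is excluded by \<open>b \<noteq> 0\<close>.\<close>
        using no_double[of z w] w b d0 by (cases "z = 0") (auto simp: power_0_left)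
      then show ?thesis by blast
    qed
    \<comment> \<open>Only one pair remains, so it serves as both.\<close>
    ultimately show thesis using that[of x1 x1] sub x1 by blast
  next
    case False
    then have "{z. a * z ^ d = - b} = {}" by blast
    then show thesis using that[of x2 x3] sub x2 x3 by blast
  qed
qed

text \<open>Infinity and 0 join the two pairs. Taking \<open>b\<close> as the image of an integral
  unit \<open>e\<close> treats both signs at once and keeps the arithmetic of numerators in the
  integers.\<close>

lemma PrePer_psi_card_le_6:
  fixes a :: rat and e :: int
  assumes d: "d \<ge> 2" and a: "a \<noteq> 0" and e: "\<bar>e\<bar> = 1"
  shows "finite (PrePer (psi d a (of_int e))) \<and> card (PrePer (psi d a (of_int e))) \<le> 6"
proof -
  let ?b = "of_int e :: rat"
  have "?b \<noteq> 0" using e by auto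
  then obtain x y where xy: "{z. \<not> wandering d ?b (a * z ^ d)} \<subseteq> {0, x, - x, y, - y}"
    using non_wandering_fibres[OF d a] by blast
  \<comment> \<open>Written as a list of length 6, so that \<open>card_length\<close> gives the
    bound even when entries coincide.\<close>
  let ?S = "set [proj1_pt 1 0, proj1_pt 0 1, proj1_pt x 1, proj1_pt (- x) 1, proj1_pt y 1, proj1_pt (- y) 1]"
  have "PrePer (psi d a ?b) \<subseteq> ?S"
  proof
    fix P assume P: "P \<in> PrePer (psi d a ?b)"
    show "P \<in> ?S"
    proof (cases P rule: proj1_affine_cases)
      case (2 z)
      then have "z \<in> {0, x, - x, y, - y}" using PrePer_not_wandering[OF d a e] P xy by blast
      then show ?thesis using 2 by auto
    qed simp
  qed
  moreover have "card ?S \<le> 6" by (rule order_trans[OF card_length]) simp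
  ultimately show ?thesis by (meson List.finite_set card_mono finite_subset order_trans)
qed

theorem theorem2p4:
  fixes d :: nat and a :: rat
  assumes "d \<ge> 2" and "a \<noteq> 0"
  shows "(finite (PrePer (psi d a 1)) \<and> card (PrePer (psi d a 1)) \<le> 6) \<and>
         (finite (PrePer (psi d a (-1))) \<and> card (PrePer (psi d a (-1))) \<le> 6)"
  using PrePer_psi_card_le_6[OF assms, of 1] PrePer_psi_card_le_6[OF assms, of "-1"] by simp

end
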